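(* Let $d\ge2$ and let $A$ be a reducible essential square binary matrix with irreducible components $A_1,\dots,A_r$. Then the hom Markov tree-shifts on the $d$-tree satisfy $$h(\mathcal{T}_A)\ge\sup_{1\le i\le r}h(\mathcal{T}_{A_i}).$$ Moreover, equality does not hold in general: there exist $d\ge2$ and a reducible essential binary matrix $A$ with irreducible components $A_1,\dots,A_r$ such that $h(\mathcal{T}_A)>\sup_{1\le i\le r}h(\mathcal{T}_{A_i})$.
   Context: A binary matrix (entries in $\{0,1\}$) is essential if it has no zero rows and no zero columns. A square binary matrix $A$ is irreducible if for all indices $i,j$ there is $n\ge1$ with $(A^n)_{i,j}>0$, and reducible otherwise. The irreducible components of $A$ are the principal submatrices of $A$ indexed by the communicating classes (strongly connected components) of the directed graph with adjacency matrix $A$. If a component is the $1\times1$ zero matrix, its tree-shift is empty and its entropy is $-\infty$ by convention. Let $\Sigma=\{0,1,\dots,d-1\}$, $\Sigma^*=\bigcup_{n\ge0}\Sigma^n$ the set of all finite words over $\Sigma$, and $\Delta_n=\bigcup_{i=0}^n\Sigma^i$. For a binary matrix $A$ indexed by a finite alphabet $\mathcal{A}$, a labeled tree is a function $t:\Sigma^*\to\mathcal{A}$, $w\mapsto t_w$. An $n$-block is a function $u:\Delta_n\to\mathcal{A}$; it appears in $t$ if there is $s\in\Sigma^*$ with $t_{sw}=u_w$ for all $w\in\Delta_n$. Then $\mathcal{T}_A=\{t\in\mathcal{A}^{\Sigma^*}: A_{t_w,t_{wi}}=1\ \forall w\in\Sigma^*, i\in\Sigma\}$, $B_n(\mathcal{T}_A)$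 is the set of $n$-blocks appearing in elements of $\mathcal{T}_A$, and the topological entropy is $h(\mathcal{T}_A)=\lim_{n\to\infty}\frac{\log|B_n(\mathcal{T}_A)|}{|\Delta_n|}$ (the limit is known to exist). *)

theory Defs
  imports
    "HOL-Analysis.Analysis"
    "Jordan_Normal_Form.Matrix"
    "Jordan_Normal_Form.DL_Submatrix"
begin

(* The alphabet of an n x n matrix is the index set {..<n}. *)

definition binary_mat :: "nat mat \<Rightarrow> bool" where
  "binary_mat A \<longleftrightarrow> (\<forall>i<dim_row A. \<forall>j<dim_col A. A $$ (i, j) \<in> {0, 1})"

definition essential_mat :: "nat mat \<Rightarrow> bool" where
  "essential_mat A \<longleftrightarrow>
     (\<forall>i<dim_row A. row A i \<noteq> 0\<^sub>v (dim_col A)) \<and> (\<forall>j<dim_col A. col A j \<noteq> 0\<^sub>v (dim_row A))"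

definition irreducible_mat :: "nat mat \<Rightarrow> bool" where
  "irreducible_mat A \<longleftrightarrow>
     square_mat A \<and> (\<forall>i<dim_row A. \<forall>j<dim_row A. \<exists>n\<ge>1. (A ^\<^sub>m n) $$ (i, j) > 0)"

definition reducible_mat :: "nat mat \<Rightarrow> bool" where
  "reducible_mat A \<longleftrightarrow> square_mat A \<and> \<not> irreducible_mat A"

definition adj_rel :: "nat mat \<Rightarrow> (nat \<times> nat) set" where
  "adj_rel A = {(i, j). i < dim_row A \<and> j < dim_row A \<and> A $$ (i, j) = 1}"

definition communicate_rel :: "nat mat \<Rightarrow> (nat \<times> nat) set" where
  "communicate_rel A =
     {(i, j). i < dim_row A \<and> j < dim_row A \<and> (i, j) \<in> (adj_rel A)\<^sup>* \<and> (j, i) \<in> (adj_rel A)\<^sup>*}"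

(* Reachability is reflexive, so a state that lies on no cycle is a class by itself; it
   contributes the 1 x 1 zero matrix as a component. *)
definition communicating_classes :: "nat mat \<Rightarrow> nat set set" where
  "communicating_classes A = {..<dim_row A} // communicate_rel A"

(* Taking principal submatrices renumbers the states of a class increasingly from 0. *)
definition irreducible_components :: "nat mat \<Rightarrow> nat mat set" where
  "irreducible_components A = (\<lambda>C. submatrix A C C) ` communicating_classes A"

definition words :: "nat \<Rightarrow> nat list set" where
  "words d = lists {..<d}"

definition words_upto :: "nat \<Rightarrow> nat \<Rightarrow> nat list set" where
  "words_upto d n = {w \<in> words d. length w \<le> n}"

(* Trees and blocks are extensional functions, so that a block is determined by its values on
   its domain and blocks are counted correctly. *)
definition tree_shift :: "nat \<Rightarrow> nat mat \<Rightarrow> (nat list \<Rightarrow> nat) set" where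
  "tree_shift d A =
     {t \<in> words d \<rightarrow>\<^sub>E {..<dim_row A}. \<forall>w\<in>words d. \<forall>i<d. A $$ (t w, t (w @ [i])) = 1}"

definition appears_in :: "nat \<Rightarrow> nat \<Rightarrow> (nat list \<Rightarrow> nat) \<Rightarrow> (nat list \<Rightarrow> nat) \<Rightarrow> bool" where
  "appears_in d n u t \<longleftrightarrow> (\<exists>s\<in>words d. \<forall>w\<in>words_upto d n. t (s @ w) = u w)"

definition blocks :: "nat \<Rightarrow> nat mat \<Rightarrow> nat \<Rightarrow> (nat list \<Rightarrow> nat) set" where
  "blocks d A n =
     {u \<in> words_upto d n \<rightarrow>\<^sub>E {..<dim_row A}. \<exists>t\<in>tree_shift d A. appears_in d n u t}"

definition entropy :: "nat \<Rightarrow> nat mat \<Rightarrow> ereal" where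
  "entropy d A =
     (if tree_shift d A = {} then -\<infinity>
      else ereal (lim (\<lambda>n. ln (real (card (blocks d A n))) / real (card (words_upto d n)))))"

end

theory Submission
  imports Defs
begin

text \<open>
  The inequality is monotonicity: a principal submatrix describes a part of the graph of \<open>A\<close>,
  so relabelling along the inclusion turns each tree of a component into a tree of \<open>A\<close>, and
  different blocks into different blocks (\<open>card_blocks_le_of_embedding\<close>).

  Comparing block counts compares entropies only because the defining limits exist, which rests on
  the recursive structure of the \<open>d\<close>-tree. A block of height \<open>n + 1\<close> consists of a root label and
  \<open>d\<close> blocks of height \<open>n\<close>, so \<open>a\<^sub>n = ln |B\<^sub>n|\<close> satisfies \<open>a\<^sub>n\<^sub>+\<^sub>1 \<le> K + d a\<^sub>n\<close>. Adding the constant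
  \<open>K / (d - 1)\<close> absorbs \<open>K\<close>, after which division by \<open>d ^ n\<close> gives a decreasing sequence bounded
  below; as \<open>|\<Delta>\<^sub>n| / d ^ n\<close> converges to \<open>d / (d - 1)\<close>, the quotient \<open>a\<^sub>n / |\<Delta>\<^sub>n|\<close> converges as well
  (\<open>convergent_entropy_sequence\<close>).

  Strict inequality already occurs for the binary tree and the \<open>2 \<times> 2\<close> upper triangular matrix of
  ones. Its components are two copies of the one-symbol matrix, with entropy \<open>0\<close>. On a path, the
  single switch from \<open>0\<close> to \<open>1\<close> could be placed in only linearly many ways, but on a tree each
  branch chooses independently: keeping \<open>0\<close> above level \<open>n\<close> leaves the \<open>2 ^ n\<close> labels on that
  level free. A positive proportion of all nodes of \<open>\<Delta>\<^sub>n\<close> lies on the last level, so the entropy is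
  at least \<open>ln 2 / 2\<close> (\<open>entropy_triangle_ge\<close>).
\<close>

section \<open>Words and blocks\<close>

lemma Nil_in_words [simp]: "[] \<in> words d"
  by (simp add: words_def)

lemma Cons_in_words [simp]: "i # w \<in> words d \<longleftrightarrow> i < d \<and> w \<in> words d"
  by (simp add: words_def)

lemma append_in_words [simp]: "v @ w \<in> words d \<longleftrightarrow> v \<in> words d \<and> w \<in> words d"
  by (simp add: words_def lists_eq_set)

lemma words_upto_eq: "words_upto d n = {w. set w \<subseteq> {..<d} \<and> length w \<le> n}"
  by (auto simp: words_upto_def words_def lists_eq_set)

lemma finite_words_upto: "finite (words_upto d n)"
  unfolding words_upto_eq by (rule finite_lists_length_le) simp

lemma card_words_upto: "card (words_upto d n) = (\<Sum>i\<le>n. d ^ i)"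
  unfolding words_upto_eq by (subst card_lists_length_le) simp_all

lemma card_words_upto_pos: "0 < card (words_upto d n)"
proof -
  have "[] \<in> words_upto d n"
    by (simp add: words_upto_def)
  then show ?thesis
    using finite_words_upto card_gt_0_iff by blast
qed

lemma card_words_upto_geometric:
  assumes "d \<ge> 2"
  shows "real (card (words_upto d n)) = (real d ^ Suc n - 1) / (real d - 1)"
proof -
  have "(\<Sum>i<Suc n. real d ^ i) = (real d ^ Suc n - 1) / (real d - 1)"
    using assms by (intro geometric_sum) auto
  then show ?thesis
    by (simp add: card_words_upto lessThan_Suc_atMost)
qed

lemma finite_blocks: "finite (blocks d A n)"
  by (rule finite_subset[of _ "words_upto d n \<rightarrow>\<^sub>E {..<dim_row A}"])
     (auto simp: blocks_def intro!: finite_PiE finite_words_upto)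

lemma tree_value_less: "t \<in> tree_shift d A \<Longrightarrow> w \<in> words d \<Longrightarrow> t w < dim_row A"
  by (auto simp: tree_shift_def)

lemma blocksI:
  assumes t: "t \<in> tree_shift d A" and s: "s \<in> words d"
  shows "(\<lambda>w\<in>words_upto d n. t (s @ w)) \<in> blocks d A n"
proof -
  have "t (s @ w) < dim_row A" if "w \<in> words_upto d n" for w
    using that s by (intro tree_value_less[OF t]) (simp add: words_upto_def)
  then show ?thesis
    using t s by (auto simp: blocks_def appears_in_def)
qed

lemma blocksE:
  assumes "u \<in> blocks d A n"
  obtains t s where "t \<in> tree_shift d A" "s \<in> words d"
    and "u = (\<lambda>w\<in>words_upto d n. t (s @ w))"
proof -
  from assms obtain t s where t: "t \<in> tree_shift d A" and s: "s \<in> words d"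
    and eq: "\<And>w. w \<in> words_upto d n \<Longrightarrow> t (s @ w) = u w"
    and ext: "u \<in> extensional (words_upto d n)"
    by (auto simp: blocks_def appears_in_def PiE_def)
  have "u = (\<lambda>w\<in>words_upto d n. t (s @ w))"
    using ext by (intro extensionalityI[of _ "words_upto d n"]) (auto simp: eq)
  with t s show ?thesis by (rule that)
qed

lemma card_blocks_pos:
  assumes "tree_shift d A \<noteq> {}"
  shows "0 < card (blocks d A n)"
proof -
  from assms obtain t where "t \<in> tree_shift d A" by blast
  then have "blocks d A n \<noteq> {}"
    using blocksI[of t d A "[]" n] by auto
  then show ?thesis
    using finite_blocks card_gt_0_iff by blast
qed

section \<open>Existence of the entropy limit\<close>

text \<open>
  A block of height \<open>n + 1\<close> is determined by its root label and the \<open>d\<close> blocks of height \<open>n\<close>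
  hanging below the root.
\<close>
lemma card_blocks_Suc_le:
  "card (blocks d A (Suc n)) \<le> dim_row A * card (blocks d A n) ^ d"
proof -
  define split where "split u =
    (u [], \<lambda>i\<in>{..<d}. \<lambda>w\<in>words_upto d n. u (i # w))" for u :: "nat list \<Rightarrow> nat"
  let ?P = "{..<dim_row A} \<times> ({..<d} \<rightarrow>\<^sub>E blocks d A n)"
  have "split u \<in> ?P" if "u \<in> blocks d A (Suc n)" for u
  proof -
    from that obtain t s where t: "t \<in> tree_shift d A" and s: "s \<in> words d"
      and u: "u = (\<lambda>w\<in>words_upto d (Suc n). t (s @ w))"
      by (rule blocksE)
    have "u [] < dim_row A"
      using tree_value_less[OF t s] by (simp add: u words_upto_def)
    moreover have "(\<lambda>w\<in>words_upto d n. u (i # w)) \<in> blocks d A n" if i: "i < d" for i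
    proof -
      have "(\<lambda>w\<in>words_upto d n. u (i # w)) = (\<lambda>w\<in>words_upto d n. t ((s @ [i]) @ w))"
        using i by (intro restrict_ext) (simp add: u words_upto_def)
      then show ?thesis
        using blocksI[OF t, of "s @ [i]" n] s i by simp
    qed
    ultimately show ?thesis
      by (auto simp: split_def)
  qed
  then have "split ` blocks d A (Suc n) \<subseteq> ?P" by blast
  moreover have "inj_on split (blocks d A (Suc n))"
  proof (rule inj_onI)
    fix u v
    assume u: "u \<in> blocks d A (Suc n)" and v: "v \<in> blocks d A (Suc n)" and eq: "split u = split v"
    have "u w = v w" if w: "w \<in> words_upto d (Suc n)" for w
    proof (cases w)
      case Nil
      then show ?thesis using eq by (simp add: split_def)
    next
      case (Cons i w')
      then have i: "i < d" and w': "w' \<in> words_upto d n"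
        using w by (auto simp: words_upto_def)
      have "snd (split u) i w' = snd (split v) i w'"
        by (simp only: eq)
      then show ?thesis
        using i w' Cons by (simp add: split_def)
    qed
    then show "u = v"
      using u v by (intro PiE_ext[of _ "words_upto d (Suc n)"]) (auto simp: blocks_def)
  qed
  ultimately have "card (blocks d A (Suc n)) \<le> card ?P"
    by (intro card_inj_on_le) (auto intro!: finite_PiE finite_blocks)
  then show ?thesis
    by (simp add: card_cartesian_product card_funcsetE)
qed

text \<open>
  The bound lets \<open>a n / d ^ n\<close> grow by at most \<open>K / d ^ Suc n\<close> in a step. These increments are
  summable, and adding their tail sum \<open>K / (d - 1) / d ^ n\<close> makes the sequence decreasing.
\<close>
lemma convergent_of_affine_growth_bound:
  fixes a :: "nat \<Rightarrow> real"
  assumes d: "1 < d" and nonneg: "\<And>n. 0 \<le> a n" and K: "0 \<le> K"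
    and step: "\<And>n. a (Suc n) \<le> K + d * a n"
  shows "convergent (\<lambda>n. a n / d ^ n)"
proof -
  let ?c = "K / (d - 1)"
  let ?e = "\<lambda>n. (a n + ?c) / d ^ n"
  have "decseq ?e"
  proof (rule decseq_SucI)
    fix n
    have "K + ?c = d * ?c"
      using d by (simp add: field_simps)
    then have "a (Suc n) + ?c \<le> d * (a n + ?c)"
      using step[of n] by (simp add: distrib_left)
    then have "(a (Suc n) + ?c) / d ^ Suc n \<le> (d * (a n + ?c)) / d ^ Suc n"
      using d by (intro divide_right_mono) auto
    also have "\<dots> = ?e n"
      using d by simp
    finally show "?e (Suc n) \<le> ?e n" .
  qed
  moreover have "\<forall>n. 0 \<le> ?e n"
    using d K nonneg by simp
  ultimately obtain L where "?e \<longlonglongrightarrow> L"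
    by (rule decseq_convergent)
  moreover have "(\<lambda>n. ?c / d ^ n) \<longlonglongrightarrow> 0"
    using d by (rule LIMSEQ_divide_realpow_zero)
  ultimately have "(\<lambda>n. ?e n - ?c / d ^ n) \<longlonglongrightarrow> L - 0"
    by (rule tendsto_diff)
  then have "(\<lambda>n. a n / d ^ n) \<longlonglongrightarrow> L"
    by (simp add: add_divide_distrib)
  then show ?thesis
    by (rule convergentI)
qed

lemma convergent_entropy_sequence:
  assumes d: "d \<ge> 2" and ne: "tree_shift d A \<noteq> {}"
  shows "convergent (\<lambda>n. ln (real (card (blocks d A n))) / real (card (words_upto d n)))"
proof -
  let ?a = "\<lambda>n. ln (real (card (blocks d A n)))"
  have pos: "0 < card (blocks d A n)" for n
    by (rule card_blocks_pos[OF ne])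
  obtain t where "t \<in> tree_shift d A"
    using ne by blast
  then have dim: "0 < dim_row A"
    using tree_value_less[of t d A "[]"] by simp
  have step: "?a (Suc n) \<le> ln (real (dim_row A)) + real d * ?a n" for n
  proof -
    have "real (card (blocks d A (Suc n))) \<le> real (dim_row A) * real (card (blocks d A n)) ^ d"
      using card_blocks_Suc_le[of d A n] by (metis of_nat_le_iff of_nat_mult of_nat_power)
    then have "?a (Suc n) \<le> ln (real (dim_row A) * real (card (blocks d A n)) ^ d)"
      using pos[of "Suc n"] by (intro ln_mono) auto
    also have "\<dots> = ln (real (dim_row A)) + real d * ?a n"
      using dim pos[of n] by (simp add: ln_mult ln_realpow)
    finally show ?thesis .
  qed
  have "convergent (\<lambda>n. ?a n / real d ^ n)"
    using d dim pos
    by (intro convergent_of_affine_growth_bound[where K = "ln (real (dim_row A))"] step)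
       (auto simp: Suc_le_eq)
  then obtain L where L: "(\<lambda>n. ?a n / real d ^ n) \<longlonglongrightarrow> L"
    by (auto simp: convergent_def)
  have "(\<lambda>n. (real d - 1 / real d ^ n) / (real d - 1)) \<longlonglongrightarrow> (real d - 0) / (real d - 1)"
    using d by (intro tendsto_intros LIMSEQ_divide_realpow_zero) auto
  \<comment> \<open>Both counts are compared with \<open>d ^ n\<close>, the scale on which each of them converges.\<close>
  moreover have "(real d - 1 / real d ^ n) / (real d - 1) = real (card (words_upto d n)) / real d ^ n" for n
    using d unfolding card_words_upto_geometric[OF d] by (simp add: field_simps)
  ultimately have D: "(\<lambda>n. real (card (words_upto d n)) / real d ^ n) \<longlonglongrightarrow> real d / (real d - 1)"
    by simp
  have "(\<lambda>n. (?a n / real d ^ n) / (real (card (words_upto d n)) / real d ^ n))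
          \<longlonglongrightarrow> L / (real d / (real d - 1))"
    using d by (intro tendsto_divide L D) auto
  then have "(\<lambda>n. ?a n / real (card (words_upto d n))) \<longlonglongrightarrow> L / (real d / (real d - 1))"
    using d by simp
  then show ?thesis
    by (rule convergentI)
qed

lemma entropy_limit:
  assumes "d \<ge> 2" and "tree_shift d A \<noteq> {}"
  obtains h where "entropy d A = ereal h"
    and "(\<lambda>n. ln (real (card (blocks d A n))) / real (card (words_upto d n))) \<longlonglongrightarrow> h"
  using convergent_entropy_sequence[OF assms] assms(2)
  by (auto simp: entropy_def convergent_LIMSEQ_iff)

section \<open>Monotonicity under embeddings\<close>

lemma embed_tree:
  assumes f: "f ` {..<dim_row B} \<subseteq> {..<dim_row A}"
    and edge: "\<And>i j. i < dim_row B \<Longrightarrow> j < dim_row B \<Longrightarrow> B $$ (i, j) = 1 \<Longrightarrow> A $$ (f i, f j) = 1"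
    and t: "t \<in> tree_shift d B"
  shows "(\<lambda>w\<in>words d. f (t w)) \<in> tree_shift d A"
proof -
  have "f (t w) < dim_row A" if "w \<in> words d" for w
    using f tree_value_less[OF t that] by auto
  moreover have "A $$ (f (t w), f (t (w @ [i]))) = 1" if "w \<in> words d" "i < d" for w i
    using that t by (intro edge tree_value_less[OF t]) (auto simp: tree_shift_def)
  ultimately show ?thesis
    by (simp add: tree_shift_def)
qed

lemma card_blocks_le_of_embedding:
  assumes inj: "inj_on f {..<dim_row B}" and f: "f ` {..<dim_row B} \<subseteq> {..<dim_row A}"
    and edge: "\<And>i j. i < dim_row B \<Longrightarrow> j < dim_row B \<Longrightarrow> B $$ (i, j) = 1 \<Longrightarrow> A $$ (f i, f j) = 1"
  shows "card (blocks d B n) \<le> card (blocks d A n)"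
proof (rule card_inj_on_le)
  let ?F = "\<lambda>u. \<lambda>w\<in>words_upto d n. f (u w)"
  show "finite (blocks d A n)"
    by (rule finite_blocks)
  show "inj_on ?F (blocks d B n)"
  proof (rule inj_onI)
    fix u v
    assume u: "u \<in> blocks d B n" and v: "v \<in> blocks d B n" and eq: "?F u = ?F v"
    have "u w = v w" if w: "w \<in> words_upto d n" for w
    proof -
      have "f (u w) = f (v w)"
        using fun_cong[OF eq, of w] w by simp
      moreover have "u w < dim_row B" "v w < dim_row B"
        using u v w by (auto simp: blocks_def)
      ultimately show ?thesis
        using inj by (auto dest: inj_onD)
    qed
    then show "u = v"
      using u v by (intro PiE_ext[of _ "words_upto d n"]) (auto simp: blocks_def)
  qed
  show "?F ` blocks d B n \<subseteq> blocks d A n"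
  proof (rule image_subsetI)
    fix u
    assume "u \<in> blocks d B n"
    then obtain t s where t: "t \<in> tree_shift d B" and s: "s \<in> words d"
      and u: "u = (\<lambda>w\<in>words_upto d n. t (s @ w))"
      by (rule blocksE)
    have "?F u = (\<lambda>w\<in>words_upto d n. (\<lambda>w\<in>words d. f (t w)) (s @ w))"
      using s by (intro restrict_ext) (simp add: u words_upto_def)
    then show "?F u \<in> blocks d A n"
      using blocksI[OF embed_tree[OF f edge t] s] by simp
  qed
qed

lemma entropy_mono_of_embedding:
  assumes d: "d \<ge> 2"
    and inj: "inj_on f {..<dim_row B}" and f: "f ` {..<dim_row B} \<subseteq> {..<dim_row A}"
    and edge: "\<And>i j. i < dim_row B \<Longrightarrow> j < dim_row B \<Longrightarrow> B $$ (i, j) = 1 \<Longrightarrow> A $$ (f i, f j) = 1"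
  shows "entropy d B \<le> entropy d A"
proof (cases "tree_shift d B = {}")
  case True
  then show ?thesis by (simp add: entropy_def)
next
  case False
  then have "tree_shift d A \<noteq> {}"
    using embed_tree[OF f edge] by blast
  then obtain h where h: "entropy d A = ereal h"
    "(\<lambda>n. ln (real (card (blocks d A n))) / real (card (words_upto d n))) \<longlonglongrightarrow> h"
    by (rule entropy_limit[OF d])
  obtain k where k: "entropy d B = ereal k"
    "(\<lambda>n. ln (real (card (blocks d B n))) / real (card (words_upto d n))) \<longlonglongrightarrow> k"
    using False by (rule entropy_limit[OF d])
  have "ln (real (card (blocks d B n))) / real (card (words_upto d n))
          \<le> ln (real (card (blocks d A n))) / real (card (words_upto d n))" for n
    using card_blocks_le_of_embedding[OF inj f edge, of d n] card_blocks_pos[OF False, of n]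
    by (intro divide_right_mono ln_mono) auto
  then have "k \<le> h"
    by (intro LIMSEQ_le[OF k(2) h(2)]) auto
  then show ?thesis
    by (simp add: h(1) k(1))
qed

lemma entropy_principal_submatrix_le:
  assumes d: "d \<ge> 2" and sq: "square_mat A"
  shows "entropy d (submatrix A C C) \<le> entropy d A"
proof (rule entropy_mono_of_embedding[OF d, where f = "pick C"])
  have dim: "dim_row (submatrix A C C) = card {i. i < dim_row A \<and> i \<in> C}"
    by (rule dim_submatrix)
  \<comment> \<open>The enumeration of \<open>C\<close> by \<open>pick\<close> is meaningful only below the cardinality of \<open>C\<close>.\<close>
  have "card {i. i < dim_row A \<and> i \<in> C} \<le> card C" if "finite C"
    using that by (intro card_mono) auto
  then have guard: "infinite C \<or> i < card C" if "i < dim_row (submatrix A C C)" for i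
    using that by (auto simp: dim)
  have "pick C i < pick C j" if "i < j" "j < dim_row (submatrix A C C)" for i j
    using guard[OF that(2)] that(1) pick_mono_inf[of C i j] pick_mono_le[of j C i] by blast
  then show "inj_on (pick C) {..<dim_row (submatrix A C C)}"
    by (intro inj_onI) (metis lessThan_iff less_irrefl nat_neq_iff)
  show "pick C ` {..<dim_row (submatrix A C C)} \<subseteq> {..<dim_row A}"
    by (auto simp: dim intro: pick_le)
  show "A $$ (pick C i, pick C j) = 1"
    if "i < dim_row (submatrix A C C)" "j < dim_row (submatrix A C C)"
      and "submatrix A C C $$ (i, j) = 1" for i j
    using that sq by (simp add: dim submatrix_index)
qed

section \<open>A reducible matrix with entropy above its components\<close>

text \<open>
  The matrix may have dimension \<open>0\<close> or be the \<open>1 \<times> 1\<close> zero matrix; the tree-shift is then empty and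
  the entropy is \<open>-\<infinity>\<close>, which is why the conclusion is an inequality.
\<close>
lemma entropy_one_symbol_le_0:
  assumes d: "d \<ge> 2" and dim: "dim_row B \<le> 1"
  shows "entropy d B \<le> 0"
proof (cases "tree_shift d B = {}")
  case True
  then show ?thesis by (simp add: entropy_def)
next
  case False
  then obtain h where h: "entropy d B = ereal h"
    "(\<lambda>n. ln (real (card (blocks d B n))) / real (card (words_upto d n))) \<longlonglongrightarrow> h"
    by (rule entropy_limit[OF d])
  have "card (blocks d B n) = 1" for n
  proof -
    have "card (blocks d B n) \<le> card (words_upto d n \<rightarrow>\<^sub>E {..<dim_row B})"
      by (rule card_mono) (auto simp: blocks_def intro!: finite_PiE finite_words_upto)
    also have "\<dots> = dim_row B ^ card (words_upto d n)"
      by (simp add: card_funcsetE finite_words_upto)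
    also have "\<dots> \<le> 1"
      by (rule power_le_one[OF _ dim]) simp
    finally show ?thesis
      using card_blocks_pos[OF False, of n] by linarith
  qed
  then have "h \<le> 0"
    using h(2) by (simp add: LIMSEQ_const_iff)
  then show ?thesis
    by (simp add: h(1))
qed

definition two_state_triangle :: "nat mat" where
  "two_state_triangle = mat 2 2 (\<lambda>(i, j). if i \<le> j then 1 else 0)"

lemma triangle_dims [simp]:
  "dim_row two_state_triangle = 2" "dim_col two_state_triangle = 2"
  by (simp_all add: two_state_triangle_def)

lemma triangle_entry:
  "i < 2 \<Longrightarrow> j < 2 \<Longrightarrow> two_state_triangle $$ (i, j) = (if i \<le> j then 1 else 0)"
  by (simp add: two_state_triangle_def)

lemma essential_triangle: "essential_mat two_state_triangle"
proof -
  have "two_state_triangle $$ (i, i) \<noteq> 0" if "i < 2" for i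
    using that by (simp add: triangle_entry)
  then show ?thesis
    unfolding essential_mat_def
    by (metis index_col index_row(1) index_zero_vec(1) triangle_dims)
qed

lemma triangle_power_entry: "(two_state_triangle ^\<^sub>m n) $$ (1, 0) = 0"
proof (induction n)
  case 0
  then show ?case by simp
next
  case (Suc n)
  have "dim_row (two_state_triangle ^\<^sub>m n) = 2" "dim_col (two_state_triangle ^\<^sub>m n) = 2"
    by (induction n) auto
  with Suc show ?case
    by (simp add: scalar_prod_def triangle_entry numeral_2_eq_2)
qed

lemma reducible_triangle: "reducible_mat two_state_triangle"
proof -
  have "\<not> irreducible_mat two_state_triangle"
  proof
    assume "irreducible_mat two_state_triangle"
    then obtain n where "0 < (two_state_triangle ^\<^sub>m n) $$ (1, 0)"
      unfolding irreducible_mat_def triangle_dims by (meson one_less_numeral_iff semiring_norm(76) zero_less_numeral)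
    then show False
      by (simp only: triangle_power_entry less_irrefl)
  qed
  then show ?thesis
    by (simp add: reducible_mat_def)
qed

text \<open>
  Edges never lead to a smaller state, so reachability is antisymmetric and each state
  communicates only with itself.
\<close>
lemma triangle_components_one_symbol:
  assumes "B \<in> irreducible_components two_state_triangle"
  shows "dim_row B \<le> 1"
proof -
  let ?A = two_state_triangle
  from assms obtain C where C: "C \<in> communicating_classes ?A" and B: "B = submatrix ?A C C"
    by (auto simp: irreducible_components_def)
  have mono: "i \<le> j" if "(i, j) \<in> (adj_rel ?A)\<^sup>*" for i j
    using that
  proof (induction rule: rtrancl_induct)
    case (step j k)
    from step.hyps(2) have "j \<le> k"
      by (auto simp: adj_rel_def triangle_entry split: if_split_asm)
    with step.IH show ?case by simp
  qed simp
  then have "communicate_rel ?A \<subseteq> Id"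
    by (auto simp: communicate_rel_def intro: antisym)
  moreover obtain x where "C = communicate_rel ?A `` {x}"
    using C by (auto simp: communicating_classes_def quotient_def)
  ultimately have "C \<subseteq> {x}" by auto
  then have "card {i. i < dim_row ?A \<and> i \<in> C} \<le> card {x}"
    by (intro card_mono) auto
  then show ?thesis
    by (simp add: B dim_submatrix)
qed

text \<open>
  The tree that is \<open>0\<close> above level \<open>n\<close>, \<open>1\<close> below it, and on level \<open>n\<close> the indicator function of
  \<open>S\<close>. Since \<open>1\<close> below level \<open>n\<close> may follow either label, \<open>S\<close> is unconstrained.
\<close>
definition switching_tree :: "nat \<Rightarrow> nat \<Rightarrow> nat list set \<Rightarrow> nat list \<Rightarrow> nat" where
  "switching_tree d n S =
     (\<lambda>w\<in>words d. if length w < n \<or> length w = n \<and> w \<notin> S then 0 else 1)"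

lemma switching_tree_in_shift: "switching_tree d n S \<in> tree_shift d two_state_triangle"
  by (auto simp: tree_shift_def switching_tree_def triangle_entry)

lemma card_blocks_triangle_ge: "2 ^ (d ^ n) \<le> card (blocks d two_state_triangle n)"
proof -
  let ?W = "{w. set w \<subseteq> {..<d} \<and> length w = n}"
  let ?F = "\<lambda>S. \<lambda>w\<in>words_upto d n. switching_tree d n S w"
  have "inj_on ?F (Pow ?W)"
  proof (rule inj_on_inverseI)
    show "{w \<in> ?W. ?F S w = 1} = S" if "S \<in> Pow ?W" for S
      using that by (auto simp: switching_tree_def words_upto_def words_def lists_eq_set)
  qed
  moreover have "?F ` Pow ?W \<subseteq> blocks d two_state_triangle n"
    using blocksI[OF switching_tree_in_shift, where s = "[]"] by auto
  ultimately have "card (Pow ?W) \<le> card (blocks d two_state_triangle n)"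
    using finite_blocks by (rule card_inj_on_le)
  moreover have "card ?W = d ^ n"
    by (simp add: card_lists_length_eq)
  ultimately show ?thesis
    by (simp add: card_Pow finite_lists_length_eq)
qed

lemma entropy_triangle_ge: "ereal (ln 2 / 2) \<le> entropy 2 two_state_triangle"
proof -
  let ?A = two_state_triangle
  have "tree_shift 2 ?A \<noteq> {}"
    using switching_tree_in_shift by blast
  then obtain h where h: "entropy 2 ?A = ereal h"
    "(\<lambda>n. ln (real (card (blocks 2 ?A n))) / real (card (words_upto 2 n))) \<longlonglongrightarrow> h"
    by (rule entropy_limit[OF order_refl])
  have "ln 2 / 2 \<le> ln (real (card (blocks 2 ?A n))) / real (card (words_upto 2 n))" for n
  proof -
    have "real (2 ^ 2 ^ n) \<le> real (card (blocks 2 ?A n))"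
      using card_blocks_triangle_ge by (subst of_nat_le_iff)
    then have "ln (2 ^ 2 ^ n) \<le> ln (real (card (blocks 2 ?A n)))"
      by (intro ln_mono) auto
    then have num: "2 ^ n * ln 2 \<le> ln (real (card (blocks 2 ?A n)))"
      by (simp add: ln_realpow)
    \<comment> \<open>Level \<open>n\<close> contains at least half of the nodes of the binary tree up to that level.\<close>
    have den: "real (card (words_upto 2 n)) \<le> 2 * 2 ^ n"
      by (simp add: card_words_upto_geometric)
    have "ln 2 / 2 = (2 ^ n * ln 2) / (2 * 2 ^ n :: real)"
      by simp
    also have "\<dots> \<le> ln (real (card (blocks 2 ?A n))) / real (card (words_upto 2 n))"
      using den card_words_upto_pos[of 2 n]
      by (intro frac_le num order_trans[OF _ num]) auto
    finally show ?thesis .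
  qed
  then have "ln 2 / 2 \<le> h"
    by (intro LIMSEQ_le_const[OF h(2)]) auto
  then show ?thesis
    by (simp add: h(1))
qed

theorem proposition4p2:
  shows "(\<forall>(d::nat) (A::nat mat).
            d \<ge> 2 \<longrightarrow> square_mat A \<longrightarrow> binary_mat A \<longrightarrow> essential_mat A \<longrightarrow> reducible_mat A \<longrightarrow>
            entropy d A \<ge> (SUP B\<in>irreducible_components A. entropy d B)) \<and>
         (\<exists>(d::nat) (A::nat mat).
            d \<ge> 2 \<and> square_mat A \<and> binary_mat A \<and> essential_mat A \<and> reducible_mat A \<and>
            entropy d A > (SUP B\<in>irreducible_components A. entropy d B))"
proof (intro conjI allI impI)
  fix d :: nat and A :: "nat mat"
  assume "d \<ge> 2" "square_mat A"
  then show "(SUP B\<in>irreducible_components A. entropy d B) \<le> entropy d A"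
    by (auto simp: irreducible_components_def intro!: SUP_least entropy_principal_submatrix_le)
next
  let ?A = two_state_triangle
  have "(SUP B\<in>irreducible_components ?A. entropy 2 B) \<le> 0"
    by (intro SUP_least entropy_one_symbol_le_0 triangle_components_one_symbol order_refl)
  also have "0 < ereal (ln 2 / 2)"
    by simp
  also have "\<dots> \<le> entropy 2 ?A"
    by (rule entropy_triangle_ge)
  finally have "(SUP B\<in>irreducible_components ?A. entropy 2 B) < entropy 2 ?A" .
  moreover have "square_mat ?A" "binary_mat ?A"
    by (auto simp: binary_mat_def triangle_entry)
  ultimately show "\<exists>(d::nat) (A::nat mat).
            d \<ge> 2 \<and> square_mat A \<and> binary_mat A \<and> essential_mat A \<and> reducible_mat A \<and>
            entropy d A > (SUP B\<in>irreducible_components A. entropy d B)"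
    using essential_triangle reducible_triangle by blast
qed

end
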